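(* Let $G$ be a $5$-regular graph on $n$ vertices that contains no clique on $6$ vertices ($K_6$) as a subgraph. Then $G$ has a path partition with at most $\frac{n}{6+\frac13}=\frac{3n}{19}$ components.
   Context: All graphs are finite, simple and undirected. A path partition of a graph $G=(V,E)$ is a set of vertex-disjoint paths of $G$ (a single vertex is allowed as a path) whose vertex sets together cover $V$; its members are called components. *)

theory Defs
  imports Main
begin

definition simple_graph :: "'a set \<Rightarrow> ('a \<Rightarrow> 'a \<Rightarrow> bool) \<Rightarrow> bool" where
  "simple_graph V E \<longleftrightarrow> finite V \<and> (\<forall>u v. E u v \<longrightarrow> u \<in> V \<and> v \<in> V)
     \<and> (\<forall>u v. E u v \<longrightarrow> E v u) \<and> (\<forall>v. \<not> E v v)"

definition degree :: "'a set \<Rightarrow> ('a \<Rightarrow> 'a \<Rightarrow> bool) \<Rightarrow> 'a \<Rightarrow> nat" where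
  "degree V E v = card {u \<in> V. E v u}"

definition regular :: "'a set \<Rightarrow> ('a \<Rightarrow> 'a \<Rightarrow> bool) \<Rightarrow> nat \<Rightarrow> bool" where
  "regular V E d \<longleftrightarrow> (\<forall>v \<in> V. degree V E v = d)"

definition has_clique :: "'a set \<Rightarrow> ('a \<Rightarrow> 'a \<Rightarrow> bool) \<Rightarrow> nat \<Rightarrow> bool" where
  "has_clique V E k \<longleftrightarrow> (\<exists>S \<subseteq> V. card S = k \<and> (\<forall>u \<in> S. \<forall>v \<in> S. u \<noteq> v \<longrightarrow> E u v))"

definition is_path :: "'a set \<Rightarrow> ('a \<Rightarrow> 'a \<Rightarrow> bool) \<Rightarrow> 'a list \<Rightarrow> bool" where
  "is_path V E p \<longleftrightarrow> p \<noteq> [] \<and> distinct p \<and> set p \<subseteq> V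
     \<and> (\<forall>i. Suc i < length p \<longrightarrow> E (p ! i) (p ! Suc i))"

definition path_partition :: "'a set \<Rightarrow> ('a \<Rightarrow> 'a \<Rightarrow> bool) \<Rightarrow> 'a list set \<Rightarrow> bool" where
  "path_partition V E P \<longleftrightarrow> (\<forall>p \<in> P. is_path V E p)
     \<and> (\<forall>p \<in> P. \<forall>q \<in> P. p \<noteq> q \<longrightarrow> set p \<inter> set q = {})
     \<and> (\<Union>p \<in> P. set p) = V"

end

theory Submission
  imports Defs
begin

text \<open>Take a path partition with the fewest components and, among those, the fewest singletons.

  It has no singletons. If \<open>s\<close> is one, then minimality forces each neighbour \<open>x\<close> of \<open>s\<close> to be the centre of
  a component \<open>[a, x, b]\<close>, and exchanging \<open>s\<close> with \<open>a\<close> gives an equally good partition. The set \<open>L\<close> of all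
  vertices that become singletons through such exchanges has all its neighbours in a set \<open>C\<close> of centres
  with \<open>card C < card L\<close>, contradicting regularity.

  Now every edge that leaves a component at one of its two ends carries a charge of 2/3 into that component,
  taken from the component at the other side of the edge. As every vertex starts with charge 1,
  it suffices that every component, say on \<open>k\<close> vertices, ends up with at least 19/3. Call a component closed if each of its vertices is an end of a Hamiltonian path of it.
  A closed component pays nothing, as minimality forbids edges between ends of different components, and it
  receives enough since each end has at most \<open>k - 1\<close> neighbours inside; only \<open>k = 6\<close> needs a leaving edge,
  which exists for a suitable Hamiltonian path because there is no 6-clique. For the other components the claim says
  that their inner vertices send at most \<open>3 (k - 1) / 2\<close> edges other than path edges to ends (its own or foreign),
  which follows from rotations and from minimality applied to consecutive inner vertices.\<close>

subsection \<open>Minimum path partitions\<close>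

lemma is_path_iff: "is_path V E p \<longleftrightarrow> p \<noteq> [] \<and> distinct p \<and> set p \<subseteq> V \<and> successively E p"
  by (auto simp: is_path_def successively_conv_nth)

text \<open>Only the vertex set of a component enters, so a component may be traversed by whichever
  Hamiltonian path suits the argument.\<close>

definition path_end :: "'a set \<Rightarrow> ('a \<Rightarrow> 'a \<Rightarrow> bool) \<Rightarrow> 'a set \<Rightarrow> 'a \<Rightarrow> bool" where
  "path_end V E S u \<longleftrightarrow> (\<exists>q. is_path V E q \<and> set q = S \<and> hd q = u)"

definition min_partition :: "'a set \<Rightarrow> ('a \<Rightarrow> 'a \<Rightarrow> bool) \<Rightarrow> 'a list set \<Rightarrow> bool" where
  "min_partition V E P \<longleftrightarrow> path_partition V E P \<and> (\<forall>Q. path_partition V E Q \<longrightarrow> card P \<le> card Q)"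

definition singletons :: "'a list set \<Rightarrow> 'a list set" where
  "singletons P = {p \<in> P. length p = 1}"

definition ends :: "'a list \<Rightarrow> 'a set" where
  "ends p = {hd p, last p}"

locale sgraph =
  fixes V :: "'a set" and E :: "'a \<Rightarrow> 'a \<Rightarrow> bool"
  assumes simple: "simple_graph V E"
begin

lemma finV: "finite V" and E_in: "E u v \<Longrightarrow> u \<in> V \<and> v \<in> V" and E_sym: "E u v \<Longrightarrow> E v u"
  and E_irrefl: "\<not> E v v"
  using simple by (auto simp: simple_graph_def)

lemma E_commute: "E u v \<longleftrightarrow> E v u"
  using E_sym by blast

lemma finite_nbrs: "finite {w. E u w}"
  by (rule finite_subset[OF _ finV]) (auto dest: E_in)

lemma is_path_rev [simp]: "is_path V E (rev p) \<longleftrightarrow> is_path V E p"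
proof -
  have "(\<lambda>x y. E y x) = E" by (auto simp: fun_eq_iff E_commute)
  then have "successively E (rev p) = successively E p" by (simp only: successively_rev)
  then show ?thesis by (simp add: is_path_iff)
qed

lemma is_path_append:
  assumes "is_path V E p" "is_path V E q" "set p \<inter> set q = {}" "E (last p) (hd q)"
  shows "is_path V E (p @ q)"
  using assms by (auto simp: is_path_iff successively_append_iff)

lemma is_path_appendD:
  assumes "is_path V E (p @ q)"
  shows "p \<noteq> [] \<Longrightarrow> is_path V E p" "q \<noteq> [] \<Longrightarrow> is_path V E q"
    "p \<noteq> [] \<Longrightarrow> q \<noteq> [] \<Longrightarrow> E (last p) (hd q)" "set p \<inter> set q = {}"
  using assms by (auto simp: is_path_iff successively_append_iff)

lemma path_end_hd: "is_path V E p \<Longrightarrow> path_end V E (set p) (hd p)"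
  by (auto simp: path_end_def)

lemma path_end_last:
  assumes "is_path V E p" shows "path_end V E (set p) (last p)"
  using assms unfolding path_end_def
  by (intro exI[of _ "rev p"]) (simp add: hd_rev)

lemma path_end_last_obtain:
  assumes "path_end V E S u"
  obtains q where "is_path V E q" "set q = S" "last q = u"
  using assms unfolding path_end_def
  by (metis is_path_rev last_rev set_rev)

lemma path_end_join:
  assumes "path_end V E S u" "path_end V E T w" "S \<inter> T = {}" "E u w"
  obtains r where "is_path V E r" "set r = S \<union> T"
proof -
  obtain p where p: "is_path V E p" "set p = S" "last p = u"
    using path_end_last_obtain[OF assms(1)] .
  obtain q where q: "is_path V E q" "set q = T" "hd q = w"
    using assms(2) by (auto simp: path_end_def)
  show thesis
    using that[of "p @ q"] is_path_append[OF p(1) q(1)] p q assms by auto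
qed

section \<open>Exchanging components of a partition\<close>

lemma path_partition_finite:
  assumes "path_partition V E P" shows "finite P"
proof (rule finite_subset)
  show "P \<subseteq> {xs. set xs \<subseteq> V \<and> distinct xs}"
    using assms by (auto simp: path_partition_def is_path_def)
qed (simp add: finite_subset_distinct finV)

text \<open>Disjointness from the kept components is inherited from \<open>S\<close>, as both
  families cover the same vertices. The second conclusion holds because paths are nonempty; it makes
  the cardinalities add up exactly.\<close>

lemma replace:
  assumes P: "path_partition V E P" and "S \<subseteq> P"
    and T: "\<And>t. t \<in> T \<Longrightarrow> is_path V E t"
    and T_disj: "\<And>t u. t \<in> T \<Longrightarrow> u \<in> T \<Longrightarrow> t \<noteq> u \<Longrightarrow> set t \<inter> set u = {}"
    and eq: "\<Union>(set ` T) = \<Union>(set ` S)"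
  shows "path_partition V E ((P - S) \<union> T)" "(P - S) \<inter> T = {}"
proof -
  have paths: "\<And>p. p \<in> P \<Longrightarrow> is_path V E p"
    and disj: "\<And>p q. p \<in> P \<Longrightarrow> q \<in> P \<Longrightarrow> p \<noteq> q \<Longrightarrow> set p \<inter> set q = {}"
    and cover: "\<Union>(set ` P) = V"
    using P by (auto simp: path_partition_def)
  have cross: "set p \<inter> set t = {}" if "p \<in> P - S" "t \<in> T" for p t
  proof -
    have "set p \<inter> set s = {}" if "s \<in> S" for s
      using disj[of p s] \<open>p \<in> P - S\<close> that \<open>S \<subseteq> P\<close> by blast
    moreover have "set t \<subseteq> \<Union>(set ` S)" using eq \<open>t \<in> T\<close> by blast
    ultimately show ?thesis by blast
  qed
  have "\<Union>(set ` ((P - S) \<union> T)) = \<Union>(set ` (P - S)) \<union> \<Union>(set ` S)"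
    by (simp only: image_Un Union_Un_distrib eq)
  also have "\<dots> = \<Union>(set ` P)" using \<open>S \<subseteq> P\<close> by blast
  finally have "\<Union>(set ` ((P - S) \<union> T)) = V" using cover by simp
  moreover have "set p \<inter> set q = {}"
    if "p \<in> (P - S) \<union> T" "q \<in> (P - S) \<union> T" "p \<noteq> q" for p q
    using that disj[of p q] T_disj[of p q] cross[of p q] cross[of q p] by blast
  ultimately show "path_partition V E ((P - S) \<union> T)"
    using paths T unfolding path_partition_def by blast
  show "(P - S) \<inter> T = {}"
  proof (rule ccontr)
    assume "(P - S) \<inter> T \<noteq> {}"
    then obtain t where t: "t \<in> P - S" "t \<in> T" by blast
    then have "set t = {}" using cross[OF t] by simp
    then show False using T[OF t(2)] by (simp add: is_path_iff)
  qed
qed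

lemma card_replace:
  assumes "finite P" "S \<subseteq> P" "finite T" "(P - S) \<inter> T = {}"
  shows "card ((P - S) \<union> T) + card S = card P + card T"
proof -
  have "card ((P - S) \<union> T) = card (P - S) + card T"
    using assms by (simp add: card_Un_disjoint)
  moreover have "card P = card (P - S) + card S"
    using assms by (metis card_Diff_subset card_mono finite_subset le_add_diff_inverse2)
  ultimately show ?thesis by simp
qed

lemma min_partition_path_partition: "min_partition V E P \<Longrightarrow> path_partition V E P"
  by (simp add: min_partition_def)

lemma min_partitionD:
  assumes "min_partition V E P"
  shows "finite P" "\<And>p. p \<in> P \<Longrightarrow> is_path V E p"
    "\<And>p q. p \<in> P \<Longrightarrow> q \<in> P \<Longrightarrow> p \<noteq> q \<Longrightarrow> set p \<inter> set q = {}" "(\<Union>p \<in> P. set p) = V"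
  using assms path_partition_finite by (auto simp: min_partition_def path_partition_def)

lemma min_partition_card_le:
  assumes P: "min_partition V E P" and "S \<subseteq> P" "finite T"
    and "\<And>t. t \<in> T \<Longrightarrow> is_path V E t"
    and "\<And>t u. t \<in> T \<Longrightarrow> u \<in> T \<Longrightarrow> t \<noteq> u \<Longrightarrow> set t \<inter> set u = {}"
    and "\<Union>(set ` T) = \<Union>(set ` S)"
  shows "card S \<le> card T"
proof -
  have pp: "path_partition V E P" using P by (simp add: min_partition_def)
  note r = replace[OF pp assms(2,4,5,6)]
  have "card P \<le> card ((P - S) \<union> T)" using P r(1) by (simp add: min_partition_def)
  then show ?thesis
    using card_replace[OF path_partition_finite[OF pp] assms(2,3) r(2)] by linarith
qed

lemma min_partition_replace:
  assumes P: "min_partition V E P" and "S \<subseteq> P" "finite T" "card T \<le> card S"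
    and "\<And>t. t \<in> T \<Longrightarrow> is_path V E t"
    and "\<And>t u. t \<in> T \<Longrightarrow> u \<in> T \<Longrightarrow> t \<noteq> u \<Longrightarrow> set t \<inter> set u = {}"
    and "\<Union>(set ` T) = \<Union>(set ` S)"
  shows "min_partition V E ((P - S) \<union> T)"
proof -
  have pp: "path_partition V E P" using P by (simp add: min_partition_def)
  note r = replace[OF pp assms(2,5,6,7)]
  have "card ((P - S) \<union> T) \<le> card P"
    using card_replace[OF path_partition_finite[OF pp] assms(2,3) r(2)] assms(4) by linarith
  then show ?thesis using P r(1) unfolding min_partition_def by (meson le_trans)
qed

lemma no_merge2:
  assumes "min_partition V E P" "p \<in> P" "q \<in> P" "p \<noteq> q" "is_path V E r" "set r = set p \<union> set q"
  shows False
  using min_partition_card_le[OF assms(1), of "{p, q}" "{r}"] assms by auto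

lemma no_merge3:
  assumes "min_partition V E P" "p \<in> P" "q \<in> P" "r \<in> P" "p \<noteq> q" "p \<noteq> r" "q \<noteq> r"
    "is_path V E s" "is_path V E t" "set s \<inter> set t = {}" "set s \<union> set t = set p \<union> set q \<union> set r"
  shows False
proof -
  have "s \<noteq> t" using assms by (auto simp: is_path_iff)
  then show False
    using min_partition_card_le[OF assms(1), of "{p, q, r}" "{s, t}"] assms by auto
qed

lemma path_ends_not_adjacent:
  assumes P: "min_partition V E P" and "p \<in> P" "q \<in> P" "p \<noteq> q"
    and "path_end V E (set p) u" "path_end V E (set q) w"
  shows "\<not> E u w"
  using path_end_join[OF assms(5,6)] no_merge2[OF assms(1-4)] min_partitionD(3)[OF assms(1-4)] by metis

section \<open>Rotations and Hamiltonian cycles of a component\<close>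

lemma is_path_rotate:
  assumes p: "is_path V E p" and "Suc i < length p" "E (p ! 0) (p ! Suc i)"
  shows "is_path V E (rev (take (Suc i) p) @ drop (Suc i) p)"
proof -
  have ap: "is_path V E (take (Suc i) p @ drop (Suc i) p)" using p by simp
  have "p \<noteq> []" using assms(2) by auto
  show ?thesis
  proof (rule is_path_append)
    have "last (rev (take (Suc i) p)) = p ! 0"
      using assms by (cases p) (auto simp: last_rev)
    then show "E (last (rev (take (Suc i) p))) (hd (drop (Suc i) p))"
      using assms by (simp add: hd_drop_conv_nth)
  qed (use is_path_appendD[OF ap] assms \<open>p \<noteq> []\<close> in auto)
qed

text \<open>Posa rotation: reversing the initial segment up to \<open>p ! i\<close> puts
  \<open>p ! 0\<close> next to \<open>p ! Suc i\<close>, and the path now starts at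
  \<open>p ! i\<close>.\<close>

lemma path_end_rotate:
  assumes p: "is_path V E p" and "Suc i < length p" "E (p ! 0) (p ! Suc i)"
  shows "path_end V E (set p) (p ! i)"
  unfolding path_end_def
proof (intro exI conjI)
  show "is_path V E (rev (take (Suc i) p) @ drop (Suc i) p)" by (rule is_path_rotate[OF assms])
  show "set (rev (take (Suc i) p) @ drop (Suc i) p) = set p"
    by (metis append_take_drop_id set_append set_rev)
  show "hd (rev (take (Suc i) p) @ drop (Suc i) p) = p ! i"
    using assms(2) by (auto simp: hd_append hd_rev last_conv_nth min_def)
qed

lemma path_end_rotate_last:
  assumes p: "is_path V E p" and "Suc i < length p" "E (last p) (p ! i)"
  shows "path_end V E (set p) (p ! Suc i)"
proof -
  define j where "j = length p - Suc (Suc i)"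
  have j: "Suc j < length (rev p)" "rev p ! j = p ! Suc i" "rev p ! Suc j = p ! i"
    using assms(2) by (auto simp: j_def rev_nth Suc_diff_Suc)
  have "rev p ! 0 = last p" using assms(2) by (cases p rule: rev_cases) auto
  then show ?thesis using path_end_rotate[of "rev p" j] p j assms(3) by simp
qed

text \<open>A Hamiltonian cycle can be cut open just before any of its vertices.\<close>

lemma path_end_cycle:
  assumes p: "is_path V E p" and "E (last p) (hd p)" and u: "u \<in> set p"
  shows "path_end V E (set p) u"
proof -
  obtain xs ys where xy: "p = xs @ u # ys" using u by (meson split_list)
  show ?thesis
  proof (cases "xs = []")
    case True
    then show ?thesis using path_end_hd[OF p] xy by simp
  next
    case False
    have ap: "is_path V E (xs @ (u # ys))" using p xy by simp
    have "is_path V E ((u # ys) @ xs)"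
      using is_path_appendD[OF ap] False assms(2) xy by (intro is_path_append) auto
    then show ?thesis unfolding path_end_def using xy by (intro exI[of _ "(u # ys) @ xs"]) auto
  qed
qed

text \<open>The path rotated along the first edge starts at \<open>p ! i\<close> and still stops at
  \<open>last p\<close>, so the second edge closes it to a cycle.\<close>

lemma path_end_crossing:
  assumes p: "is_path V E p" and i: "Suc i < length p" "E (p ! 0) (p ! Suc i)" "E (last p) (p ! i)"
    and u: "u \<in> set p"
  shows "path_end V E (set p) u"
proof -
  let ?q = "rev (take (Suc i) p) @ drop (Suc i) p"
  have "set ?q = set p" by (metis append_take_drop_id set_append set_rev)
  moreover have "hd ?q = p ! i" using i by (auto simp: hd_append hd_rev last_conv_nth min_def)
  moreover have "last ?q = last p" using i by simp
  ultimately show ?thesis using path_end_cycle[OF is_path_rotate[OF p i(1,2)], of u] i u by simp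
qed

text \<open>Cutting the component of \<open>x\<close> behind \<open>x\<close> and attaching
  \<open>s\<close> to \<open>x\<close> keeps the number of components. It would save a singleton
  unless the piece cut off is a singleton itself; applied to both sides of \<open>x\<close>, this
  leaves one vertex on each side.\<close>

lemma singleton_nbr_centre:
  assumes P: "min_partition V E P" "\<And>Q. min_partition V E Q \<Longrightarrow> card (singletons P) \<le> card (singletons Q)"
    and s: "[s] \<in> P" "E s x"
  shows "\<exists>a b. [a, x, b] \<in> P"
proof -
  note Pd = min_partitionD[OF P(1)]
  obtain p where p: "p \<in> P" "x \<in> set p" using Pd(4) E_in[OF s(2)] by blast
  obtain ys zs where split: "p = ys @ x # zs" using p(2) by (meson split_list)
  have ne: "p \<noteq> [s]" using p(2) s(2) E_irrefl by auto
  then have disj: "s \<notin> set p" using Pd(3)[OF p(1) s(1)] by simp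
  have sV: "is_path V E [s]" using Pd(2)[OF s(1)] .
  have pp: "is_path V E p" using Pd(2)[OF p(1)] .
  have "\<not> path_end V E (set p) x"
    using path_ends_not_adjacent[OF P(1) s(1) p(1)] ne path_end_hd[OF sV] s(2) by auto
  then have "ys \<noteq> []" "zs \<noteq> []"
    using path_end_hd[OF pp] path_end_last[OF pp] split by auto
  \<comment> \<open>Stated for arbitrary \<open>ys\<close> and \<open>zs\<close> so that it applies
    both to \<open>p\<close> and to its reversal.\<close>
  have len: "length zs = 1"
    if q: "is_path V E (ys @ x # zs)" "set (ys @ x # zs) = set p" "ys \<noteq> []" "zs \<noteq> []" for ys zs
  proof (rule ccontr)
    assume nl: "length zs \<noteq> 1"
    have ap: "is_path V E ((ys @ [x]) @ zs)" using q(1) by simp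
    have p1: "is_path V E (ys @ [x])" and p2: "is_path V E zs"
      using is_path_appendD[OF ap] q by auto
    have p3: "is_path V E (s # rev (ys @ [x]))"
    proof -
      have "is_path V E ([s] @ rev (ys @ [x]))"
        by (rule is_path_append) (use sV p1 disj s(2) q(2)[symmetric] in \<open>simp_all del: rev_append\<close>, simp)
      then show ?thesis by simp
    qed
    let ?S = "{[s], p}" and ?T = "{s # rev (ys @ [x]), zs}"
    have dz: "set zs \<inter> set (s # rev (ys @ [x])) = {}"
      using is_path_appendD(4)[OF ap] disj q(2) by auto
    then have ne2: "s # rev (ys @ [x]) \<noteq> zs" using p2 by (auto simp: is_path_iff)
    have S: "?S \<subseteq> P" using s p by simp
    have T: "\<And>t. t \<in> ?T \<Longrightarrow> is_path V E t" using p3 p2 by auto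
    have Td: "\<And>t u. t \<in> ?T \<Longrightarrow> u \<in> ?T \<Longrightarrow> t \<noteq> u \<Longrightarrow> set t \<inter> set u = {}" using dz by blast
    have U: "\<Union>(set ` ?T) = \<Union>(set ` ?S)" using q(2) by auto
    have "min_partition V E ((P - ?S) \<union> ?T)"
      by (rule min_partition_replace[OF P(1) S _ _ T Td U]) (use ne ne2 in auto)
    then have le: "card (singletons P) \<le> card (singletons ((P - ?S) \<union> ?T))" by (rule P(2))
    \<comment> \<open>The path through \<open>s\<close> has at least two vertices and
      \<open>zs\<close> does not have exactly one, so \<open>[s]\<close> is lost and no singleton is
      gained.\<close>
    have "singletons ((P - ?S) \<union> ?T) \<subseteq> singletons P - {[s]}"
      using nl by (auto simp: singletons_def)
    then have "card (singletons ((P - ?S) \<union> ?T)) \<le> card (singletons P - {[s]})"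
      by (intro card_mono) (auto simp: singletons_def Pd(1))
    also have "\<dots> < card (singletons P)"
      by (rule card_Diff1_less) (simp_all add: singletons_def Pd(1) s(1))
    finally show False using le by simp
  qed
  have "length zs = 1" using len[of ys zs] pp split \<open>ys \<noteq> []\<close> \<open>zs \<noteq> []\<close> by simp
  moreover have "length (rev ys) = 1"
  proof (rule len)
    have "rev zs @ x # rev ys = rev p" using split by simp
    then show "is_path V E (rev zs @ x # rev ys)" "set (rev zs @ x # rev ys) = set p"
      using pp by simp_all
  qed (use \<open>ys \<noteq> []\<close> \<open>zs \<noteq> []\<close> in simp_all)
  ultimately obtain a b where "ys = [a]" "zs = [b]"
    by (auto simp: length_Suc_conv)
  then show ?thesis using p split by auto
qed

subsection \<open>Elimination of singletons\<close>

definition optimal :: "'a list set \<Rightarrow> bool" where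
  "optimal P \<longleftrightarrow> min_partition V E P
     \<and> (\<forall>Q. min_partition V E Q \<longrightarrow> card (singletons P) \<le> card (singletons Q))"

definition swap :: "'a list set \<Rightarrow> 'a \<Rightarrow> 'a \<Rightarrow> 'a \<Rightarrow> 'a \<Rightarrow> 'a list set" where
  "swap P s a x b = (P - {[s], [a, x, b]}) \<union> {[a], [s, x, b]}"

text \<open>\<open>[a]\<close> takes over the role of \<open>[s]\<close>, so neither the number of
  components nor that of singletons grows.\<close>

lemma optimal_swap:
  assumes P: "optimal P" and s: "[s] \<in> P" "[a, x, b] \<in> P" "E s x"
  shows "optimal (swap P s a x b)"
proof -
  have mP: "min_partition V E P" using P by (simp add: optimal_def)
  note Pd = min_partitionD[OF mP]
  have p: "is_path V E [a, x, b]" and q: "is_path V E [s]" using Pd(2) s by auto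
  have "set [s] \<inter> set [a, x, b] = {}" by (rule Pd(3)) (use s in auto)
  then have dist: "s \<noteq> a" "s \<noteq> x" "s \<noteq> b" by auto
  have dist': "a \<noteq> x" "a \<noteq> b" "x \<noteq> b" using p by (auto simp: is_path_iff)
  let ?S = "{[s], [a, x, b]}" and ?T = "{[a], [s, x, b]}"
  have T: "is_path V E t" if "t \<in> ?T" for t
    using that p q dist s(3) by (auto simp: is_path_iff)
  have Td: "\<And>t u. t \<in> ?T \<Longrightarrow> u \<in> ?T \<Longrightarrow> t \<noteq> u \<Longrightarrow> set t \<inter> set u = {}"
    using dist dist' by auto
  have mQ: "min_partition V E (swap P s a x b)"
    unfolding swap_def
    by (rule min_partition_replace[OF mP _ _ _ T Td]) (use s dist in auto)
  have fin: "finite (singletons P)" by (simp add: singletons_def Pd(1))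
  have mem: "[s] \<in> singletons P" using s by (simp add: singletons_def)
  have "singletons (swap P s a x b) \<subseteq> insert [a] (singletons P - {[s]})"
    by (auto simp: singletons_def swap_def)
  then have "card (singletons (swap P s a x b)) \<le> card (insert [a] (singletons P - {[s]}))"
    by (intro card_mono) (use fin in auto)
  also have "\<dots> \<le> Suc (card (singletons P - {[s]}))" by (rule card_insert_le_m1) auto
  also have "\<dots> = card (singletons P)" by (rule card_Suc_Diff1[OF fin mem])
  finally show ?thesis
    using P mQ unfolding optimal_def by (meson le_trans)
qed

inductive reachable :: "'a list set \<Rightarrow> 'a list set \<Rightarrow> bool" for P0 where
  reachable_refl: "reachable P0 P0"
| reachable_swap: "reachable P0 P \<Longrightarrow> [s] \<in> P \<Longrightarrow> [a, x, b] \<in> P \<Longrightarrow> E s x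
    \<Longrightarrow> reachable P0 (swap P s a x b)"

definition reachable_singles :: "'a list set \<Rightarrow> 'a set" where
  "reachable_singles P0 = {v. \<exists>P. reachable P0 P \<and> [v] \<in> P}"

lemma reachable_optimal: "reachable P0 P \<Longrightarrow> optimal P0 \<Longrightarrow> optimal P"
  by (induction rule: reachable.induct) (auto intro: optimal_swap)

text \<open>Centres of three-vertex paths stay centres, and the first vertex of such a path in \<open>P0\<close> can only
  lose that role by becoming a singleton on the way.\<close>

lemma reachable_centre:
  assumes "reachable P0 P" "[a, x, b] \<in> P"
  shows "\<exists>a0 b0. [a0, x, b0] \<in> P0 \<and> (a0 = a \<or> a0 \<in> reachable_singles P0)"
  using assms
proof (induction arbitrary: a x b rule: reachable.induct)
  case reachable_refl
  then show ?case by blast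
next
  case (reachable_swap P s a' x' b')
  have a': "a' \<in> reachable_singles P0"
    using reachable.reachable_swap[OF reachable_swap.hyps(1-4)]
    by (auto simp: reachable_singles_def swap_def)
  consider "[a, x, b] \<in> P" | "x = x'"
    using reachable_swap.prems by (auto simp: swap_def)
  then show ?case
  proof cases
    case 1
    then show ?thesis by (rule reachable_swap.IH)
  next
    \<comment> \<open>This covers the new path \<open>[s, x', b']\<close>: its predecessor
      \<open>[a', x', b']\<close> traces back to \<open>P0\<close>, and \<open>a'\<close> has just
      become a singleton.\<close>
    case 2
    then show ?thesis using reachable_swap.IH[OF reachable_swap.hyps(3)] a' by blast
  qed
qed

text \<open>In a regular graph of positive degree a vertex set has at least as many neighbours as
  members. Yet the neighbours \<open>C\<close> of the reachable singletons \<open>L\<close> inject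
  into \<open>L - {s}\<close>.\<close>

lemma optimal_no_singletons:
  assumes P: "optimal P" and reg: "regular V E d" "d > 0"
  shows "[s] \<notin> P"
proof
  assume s: "[s] \<in> P"
  define L where "L = reachable_singles P"
  define C where "C = {x. \<exists>v\<in>L. E v x}"
  have mP: "min_partition V E P" using P by (simp add: optimal_def)
  note Pd = min_partitionD[OF mP]
  have "L \<subseteq> V"
  proof
    fix v assume "v \<in> L"
    then obtain Q where "reachable P Q" "[v] \<in> Q" by (auto simp: L_def reachable_singles_def)
    then have "is_path V E [v]"
      using reachable_optimal[OF _ P] min_partitionD(2)[of Q] by (auto simp: optimal_def)
    then show "v \<in> V" by (simp add: is_path_iff)
  qed
  have "C \<subseteq> V" using E_in by (auto simp: C_def)
  have finL: "finite L" and finC: "finite C"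
    using \<open>L \<subseteq> V\<close> \<open>C \<subseteq> V\<close> finV finite_subset by auto
  have "s \<in> L" using s reachable_refl by (auto simp: L_def reachable_singles_def)
  have "\<exists>a0. a0 \<in> L \<and> (\<exists>b0. [a0, x, b0] \<in> P)" if x: "x \<in> C" for x
  proof -
    obtain v Q where v: "E v x" "reachable P Q" "[v] \<in> Q"
      using x unfolding C_def L_def reachable_singles_def by blast
    have oQ: "optimal Q" using reachable_optimal[OF v(2) P] .
    obtain a b where ab: "[a, x, b] \<in> Q"
      using singleton_nbr_centre[OF _ _ v(3,1)] oQ by (auto simp: optimal_def)
    \<comment> \<open>A swap at \<open>x\<close> frees \<open>a\<close>, so under both alternatives
      of \<open>reachable_centre\<close> the first vertex found in \<open>P\<close> lies in
      \<open>L\<close>.\<close>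
    have "a \<in> L"
      using reachable_swap[OF v(2,3) ab v(1)] by (auto simp: L_def reachable_singles_def swap_def)
    then show ?thesis using reachable_centre[OF v(2) ab] by (auto simp: L_def)
  qed
  then obtain f where f: "\<And>x. x \<in> C \<Longrightarrow> f x \<in> L" "\<And>x. x \<in> C \<Longrightarrow> \<exists>b. [f x, x, b] \<in> P" by metis
  have "inj_on f C"
  proof (rule inj_onI)
    fix x y assume xy: "x \<in> C" "y \<in> C" "f x = f y"
    obtain b c where bc: "[f x, x, b] \<in> P" "[f y, y, c] \<in> P" using f(2) xy by blast
    have "[f x, x, b] = [f y, y, c]"
    proof (rule ccontr)
      assume "[f x, x, b] \<noteq> [f y, y, c]"
      from Pd(3)[OF bc this] xy(3) show False by simp
    qed
    then show "x = y" by simp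
  qed
  \<comment> \<open>In \<open>P\<close> itself \<open>s\<close> forms a component alone and cannot
    start a longer path; this makes the inequality strict.\<close>
  moreover have "f x \<noteq> s" if x: "x \<in> C" for x
  proof
    assume "f x = s"
    obtain b where b: "[f x, x, b] \<in> P" using f(2) x by blast
    have "[f x, x, b] \<noteq> [s]" by simp
    from Pd(3)[OF b s this] \<open>f x = s\<close> show False by simp
  qed
  ultimately have "card C \<le> card (L - {s})"
    by (intro card_inj_on_le[of f]) (use f(1) finL in auto)
  also have "\<dots> < card L" using finL \<open>s \<in> L\<close> by (rule card_Diff1_less)
  finally have less: "card C < card L" .
  have deg: "card {w. E v w} = d" if "v \<in> V" for v
  proof -
    have "{w. E v w} = {u \<in> V. E v u}" using E_in by blast
    then show ?thesis using that reg(1) by (simp add: regular_def degree_def)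
  qed
  \<comment> \<open>Double counting: every edge from \<open>L\<close> ends in \<open>C\<close>, so
    reversing the pairs embeds them into those starting in \<open>C\<close>.\<close>
  have "d * card L = card (SIGMA v:L. {w. E v w})"
    using deg \<open>L \<subseteq> V\<close> finL finite_nbrs by (subst card_SigmaI) (auto simp: subset_iff)
  also have "\<dots> \<le> card (SIGMA x:C. {w. E x w})"
    by (rule card_inj_on_le[of prod.swap])
      (use finC finite_nbrs E_sym in \<open>auto simp: C_def inj_on_def\<close>)
  also have "\<dots> = d * card C"
    using deg \<open>C \<subseteq> V\<close> finC finite_nbrs by (subst card_SigmaI) (auto simp: subset_iff)
  finally show False using less \<open>d > 0\<close> by simp
qed

end

subsection \<open>Charging\<close>

text \<open>Every vertex of a path distributes twice its load \<open>n + a + b\<close> over the two adjacent path edges: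
  \<open>gap_share a b n\<close> goes to the left edge and \<open>gap_share b a n\<close> to the right one. The values are
  chosen such that no path edge receives more than 3.\<close>

definition gap_share :: "bool \<Rightarrow> bool \<Rightarrow> nat \<Rightarrow> nat" where
  "gap_share a b n =
    (if a then (if b then 2 + n else if n = 0 then 2 else 3)
     else if b then (if n \<le> 1 then n else 3) else n)"

text \<open>The load bound allows \<open>n \<le> 2\<close> with one flag and
  \<open>n \<le> 1\<close> with two. For one flag and \<open>n = 0, 1, 2\<close> the splits are 2 +
  0, 3 + 1 and 3 + 3.\<close>

lemma gap_share_sum:
  assumes "n + of_bool a + of_bool b \<le> (3::nat)"
  shows "gap_share a b n + gap_share b a n = 2 * (n + of_bool a + of_bool b)"
proof -
  have "n = 0 \<or> n = 1 \<or> n = 2 \<or> n = 3" using assms by auto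
  then show ?thesis using assms by (auto simp: gap_share_def)
qed

text \<open>Passes from vertices to the gaps between consecutive ones, with the two outermost shares
  left over.\<close>

lemma sum_gaps:
  fixes l r :: "nat \<Rightarrow> nat"
  shows "(\<Sum>j<Suc m. l j + r j) = l 0 + (\<Sum>j<m. r j + l (Suc j)) + r m"
  by (induction m) auto

text \<open>The first and last vertex carry no load, so the doubled load is spread over
  \<open>m\<close> gaps, each receiving at most 3.\<close>

lemma sum_load_le:
  fixes n :: "nat \<Rightarrow> nat" and a b :: "nat \<Rightarrow> bool"
  defines "t \<equiv> \<lambda>j. n j + of_bool (a j) + of_bool (b j)"
  assumes a: "\<And>j. j < m \<Longrightarrow> a (Suc j) \<Longrightarrow> n j = 0 \<and> \<not> b j"
    and b: "\<And>j. j < m \<Longrightarrow> b j \<Longrightarrow> n (Suc j) = 0 \<and> \<not> a (Suc j)"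
    and n: "\<And>j. j < m \<Longrightarrow> n j > 0 \<Longrightarrow> n (Suc j) > 0 \<Longrightarrow> n j = 1 \<and> n (Suc j) = 1"
    and le: "\<And>j. j \<le> m \<Longrightarrow> t j \<le> 3" and t0: "t 0 = 0" and tm: "t m = 0"
  shows "2 * (\<Sum>j<Suc m. t j) \<le> 3 * m"
proof -
  define l r where "l j = gap_share (a j) (b j) (n j)" and "r j = gap_share (b j) (a j) (n j)" for j
  have lr: "l j + r j = 2 * t j" if "j \<le> m" for j
    using gap_share_sum[of "n j" "a j" "b j"] le[OF that] by (simp add: t_def l_def r_def)
  have "2 * (\<Sum>j<Suc m. t j) = (\<Sum>j<Suc m. l j + r j)"
    unfolding sum_distrib_left by (rule sum.cong) (auto simp: lr)
  also have "\<dots> = (\<Sum>j<m. r j + l (Suc j))"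
    using lr[of 0] lr[of m] t0 tm by (simp only: sum_gaps) simp
  also have "\<dots> \<le> (\<Sum>j<m. 3)"
  proof (rule sum_mono)
    fix j assume "j \<in> {..<m}"
    then have j: "j < m" by simp
    have t3: "t j \<le> 3" "t (Suc j) \<le> 3" using le j by auto
    \<comment> \<open>No single share exceeds 3. A flag facing the gap (\<open>b j\<close> or
      \<open>a (Suc j)\<close>) forces the share from the other side to be 0. Without such a flag, a
      vertex with \<open>n = 0\<close> gives 0 and one with \<open>n = 1\<close> gives 1.\<close>
    consider "n j = 0" | "n (Suc j) = 0" | "n j = 1" "n (Suc j) = 1" using n[OF j] by blast
    then show "r j + l (Suc j) \<le> 3"
      using a[OF j] b[OF j] t3
      by cases (cases "a j"; cases "b j"; cases "a (Suc j)"; cases "b (Suc j)";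
        auto simp: r_def l_def gap_share_def t_def split: if_splits)+
  qed
  finally show ?thesis by simp
qed

section \<open>Edges between path ends and other components\<close>

context sgraph
begin

text \<open>Pairs are oriented away from the path end, so a pair that is outgoing for one component
  is incoming for another.\<close>

definition out_edges :: "'a list \<Rightarrow> ('a \<times> 'a) set" where
  "out_edges p = (SIGMA u:ends p. {w. E u w \<and> w \<notin> set p})"

definition in_edges :: "'a list set \<Rightarrow> 'a list \<Rightarrow> ('a \<times> 'a) set" where
  "in_edges P p = {(u, w). u \<in> \<Union>(ends ` P) - set p \<and> w \<in> set p \<and> E u w}"

lemma finite_edges: "finite {(u, w). E u w}"
  by (rule finite_subset[of _ "V \<times> V"]) (auto dest: E_in simp: finV)

lemma finite_out_edges: "finite (out_edges p)" and finite_in_edges: "finite (in_edges P p)"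
  by (rule finite_subset[OF _ finite_edges], auto simp: out_edges_def in_edges_def)+

lemma ends_subset: "is_path V E p \<Longrightarrow> ends p \<subseteq> set p"
  by (auto simp: ends_def is_path_iff)

text \<open>Moving charge conserves the total: both sums count the pairs from an end of one
  component to a vertex of a different one.\<close>

lemma sum_out_edges_eq_sum_in_edges:
  assumes P: "min_partition V E P"
  shows "(\<Sum>p\<in>P. card (out_edges p)) = (\<Sum>p\<in>P. card (in_edges P p))"
proof -
  note Pd = min_partitionD[OF P]
  have "(\<Sum>p\<in>P. card (out_edges p)) = card (\<Union>p\<in>P. out_edges p)"
  proof (rule card_UN_disjoint[symmetric])
    show "\<forall>p\<in>P. \<forall>q\<in>P. p \<noteq> q \<longrightarrow> out_edges p \<inter> out_edges q = {}"
    proof (intro ballI impI)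
      fix p q assume pq: "p \<in> P" "q \<in> P" "p \<noteq> q"
      have "ends p \<inter> ends q = {}"
        using Pd(3)[OF pq] ends_subset[OF Pd(2)[OF pq(1)]] ends_subset[OF Pd(2)[OF pq(2)]] by blast
      then show "out_edges p \<inter> out_edges q = {}" unfolding out_edges_def by blast
    qed
  qed (simp_all add: Pd(1) finite_out_edges)
  also have "(\<Union>p\<in>P. out_edges p) = (\<Union>p\<in>P. in_edges P p)" (is "?L = ?R")
  proof (intro equalityI subsetI)
    fix e assume "e \<in> ?L"
    then obtain u w p where e: "e = (u, w)" "p \<in> P" "u \<in> ends p" "E u w" "w \<notin> set p"
      by (auto simp: out_edges_def)
    obtain q where q: "q \<in> P" "w \<in> set q" using Pd(4) E_in[OF e(4)] by blast
    then have "u \<notin> set q" using Pd(3)[OF e(2) q(1)] ends_subset[OF Pd(2)[OF e(2)]] e by blast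
    then show "e \<in> ?R" using e q by (auto simp: in_edges_def)
  next
    fix e assume "e \<in> ?R"
    then obtain u w p q where e: "e = (u, w)" "p \<in> P" "w \<in> set p" "E u w" "u \<notin> set p"
      "q \<in> P" "u \<in> ends q" by (auto simp: in_edges_def)
    then have "w \<notin> set q" using Pd(3)[OF e(2) e(6)] ends_subset[OF Pd(2)[OF e(6)]] by blast
    then show "e \<in> ?L" using e by (auto simp: out_edges_def)
  qed
  also have "card \<dots> = (\<Sum>p\<in>P. card (in_edges P p))"
  proof (rule card_UN_disjoint)
    show "\<forall>p\<in>P. \<forall>q\<in>P. p \<noteq> q \<longrightarrow> in_edges P p \<inter> in_edges P q = {}"
    proof (intro ballI impI)
      fix p q assume pq: "p \<in> P" "q \<in> P" "p \<noteq> q"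
      show "in_edges P p \<inter> in_edges P q = {}" using Pd(3)[OF pq] unfolding in_edges_def by blast
    qed
  qed (simp_all add: Pd(1) finite_in_edges)
  finally show ?thesis .
qed

lemma sum_length_partition:
  assumes P: "min_partition V E P"
  shows "(\<Sum>p\<in>P. length p) = card V"
proof -
  note Pd = min_partitionD[OF P]
  have "card V = card (\<Union>p\<in>P. set p)" using Pd(4) by simp
  also have "\<dots> = (\<Sum>p\<in>P. card (set p))"
    by (rule card_UN_disjoint) (use Pd in auto)
  also have "\<dots> = (\<Sum>p\<in>P. length p)"
    using Pd(2) by (intro sum.cong) (auto simp: is_path_iff distinct_card)
  finally show ?thesis by simp
qed

lemma ends_path_end: "is_path V E p \<Longrightarrow> u \<in> ends p \<Longrightarrow> path_end V E (set p) u"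
  using path_end_hd path_end_last by (auto simp: ends_def)

lemma outer_end_not_adjacent:
  assumes P: "min_partition V E P" and p: "p \<in> P" "path_end V E (set p) w"
    and u: "u \<in> \<Union>(ends ` P) - set p"
  shows "\<not> E u w"
proof -
  note Pd = min_partitionD[OF P]
  obtain q where q: "q \<in> P" "u \<in> ends q" using u by blast
  then have "q \<noteq> p" using ends_subset[OF Pd(2)[OF q(1)]] u by blast
  then show ?thesis
    using path_ends_not_adjacent[OF P q(1) p(1)] ends_path_end[OF Pd(2)[OF q(1)] q(2)] p(2) by blast
qed

text \<open>Otherwise cut \<open>p\<close> between the two vertices. If \<open>u\<close> and
  \<open>w\<close> end different components, each of these absorbs one half of \<open>p\<close>,
  turning three paths into two; if they end the same component, it fits between the halves and two
  paths become one.\<close>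

lemma outer_end_unique:
  assumes P: "min_partition V E P" and p: "p \<in> P" "Suc i < length p"
    and u: "u \<in> \<Union>(ends ` P) - set p" "E u (p ! i)"
    and w: "w \<in> \<Union>(ends ` P) - set p" "E w (p ! Suc i)"
  shows "u = w"
proof (rule ccontr)
  assume "u \<noteq> w"
  note Pd = min_partitionD[OF P]
  obtain q r where q: "q \<in> P" "u \<in> ends q" and r: "r \<in> P" "w \<in> ends r" using u w by blast
  have qp: "q \<noteq> p" using ends_subset[OF Pd(2)[OF q(1)]] u q by blast
  have rp: "r \<noteq> p" using ends_subset[OF Pd(2)[OF r(1)]] w r by blast
  note disj = Pd(3)[OF q(1) p(1) qp] Pd(3)[OF r(1) p(1) rp]
  define x y where "x = take (Suc i) p" and "y = drop (Suc i) p"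
  have xy: "x @ y = p" "x \<noteq> []" "y \<noteq> []" using p by (auto simp: x_def y_def)
  have lx: "last x = p ! i" using p(2) by (simp add: x_def take_Suc_conv_app_nth)
  have hy: "hd y = p ! Suc i" using p(2) by (simp add: y_def hd_drop_conv_nth)
  have "is_path V E (x @ y)" using Pd(2) p xy by simp
  note xyp = is_path_appendD[OF this]
  have px: "is_path V E x" and py: "is_path V E y" using xyp xy by auto
  have sp: "set p = set x \<union> set y" using xy(1) by (metis set_append)
  show False
  proof (cases "q = r")
    case False
    obtain s where s: "is_path V E s" "set s = set q \<union> set x"
      using path_end_join[OF ends_path_end[OF Pd(2)[OF q(1)] q(2)] path_end_last[OF px]]
        disj(1) sp u(2) lx by (metis Int_Un_distrib Un_empty)
    obtain t where t: "is_path V E t" "set t = set r \<union> set y"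
      using path_end_join[OF ends_path_end[OF Pd(2)[OF r(1)] r(2)] path_end_hd[OF py]]
        disj(2) sp w(2) hy by (metis Int_Un_distrib Un_empty)
    have "set s \<inter> set t = {}"
      using s(2) t(2) disj sp Pd(3)[OF q(1) r(1) False] xyp(4) by blast
    then show False
      using no_merge3[OF P p(1) q(1) r(1) qp[symmetric] rp[symmetric] False s(1) t(1)] s(2) t(2) sp
      by blast
  next
    case True
    obtain z where z: "is_path V E z" "set z = set q" "hd z = u" "last z = w"
    proof -
      have "u = hd q \<and> w = last q \<or> u = last q \<and> w = hd q"
        using q(2) r(2) True \<open>u \<noteq> w\<close> by (auto simp: ends_def)
      then show thesis
        using that[of q] that[of "rev q"] Pd(2)[OF q(1)] by (auto simp: hd_rev last_rev)
    qed
    have "is_path V E (x @ z)"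
      by (rule is_path_append[OF px z(1)]) (use disj sp z u(2) lx E_sym in auto)
    then have "is_path V E ((x @ z) @ y)"
      by (rule is_path_append[OF _ py])
        (use xyp(4) disj sp z w(2) hy in \<open>auto simp: is_path_iff\<close>)
    then show False
      by (rule no_merge2[OF P p(1) q(1) qp[symmetric]]) (use z(2) sp in auto)
  qed
qed

section \<open>Charge bounds for a single component\<close>

lemma card_nbrs_split:
  assumes "regular V E d" "u \<in> V"
  shows "card {w. E u w \<and> w \<in> A} + card {w. E u w \<and> w \<notin> A} = d"
proof -
  have "{w. E u w} = {u' \<in> V. E u u'}" using E_in by blast
  then have "card {w. E u w} = d" using assms by (simp add: regular_def degree_def)
  moreover have "card {w. E u w} = card ({w. E u w \<and> w \<in> A} \<union> {w. E u w \<and> w \<notin> A})"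
    by (rule arg_cong) blast
  moreover have "\<dots> = card {w. E u w \<and> w \<in> A} + card {w. E u w \<and> w \<notin> A}"
    by (rule card_Un_disjoint) (auto intro: finite_subset[OF _ finite_nbrs[of u]])
  ultimately show ?thesis by linarith
qed

lemma card_out_edges:
  assumes "is_path V E p" "length p \<ge> 2"
  shows "card (out_edges p) = card {w. E (hd p) w \<and> w \<notin> set p} + card {w. E (last p) w \<and> w \<notin> set p}"
proof -
  have "hd p \<noteq> last p" using assms by (cases p) (auto simp: is_path_iff)
  then show ?thesis
    unfolding out_edges_def ends_def
    by (subst card_SigmaI) (auto intro: finite_subset[OF _ finite_nbrs])
qed

lemma card_nbrs_in_path:
  assumes "is_path V E p" "u \<in> set p"
  shows "card {w. E u w \<and> w \<in> set p} + 1 \<le> length p"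
proof -
  have "card {w. E u w \<and> w \<in> set p} \<le> card (set p - {u})"
    by (rule card_mono) (auto simp: E_irrefl)
  moreover have "card (set p) = length p" using assms by (simp add: is_path_iff distinct_card)
  moreover have "length p > 0" using assms by (auto simp: is_path_iff)
  ultimately show ?thesis using assms(2) by (simp add: le_diff_conv2 Suc_le_eq del: length_greater_0_conv)
qed

text \<open>Nothing enters, as every vertex is a path end. With \<open>k = length p\<close>, each
  end has at least \<open>5 - (k - 1)\<close> neighbours outside.\<close>

lemma closed_path_bound:
  assumes P: "min_partition V E P" and reg: "regular V E 5"
    and p: "p \<in> P" "length p \<ge> 2" "length p = 6 \<Longrightarrow> out_edges p \<noteq> {}"
    and closed: "\<And>w. w \<in> set p \<Longrightarrow> path_end V E (set p) w"
  shows "19 + 2 * card (in_edges P p) \<le> 3 * length p + 2 * card (out_edges p)"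
proof -
  note Pd = min_partitionD[OF P]
  have pp: "is_path V E p" using Pd(2) p by simp
  have mem: "hd p \<in> set p" "last p \<in> set p" using pp by (auto simp: is_path_iff)
  then have "hd p \<in> V" "last p \<in> V" using pp by (auto simp: is_path_iff)
  note split = card_nbrs_split[OF reg this(1), of "set p"] card_nbrs_split[OF reg this(2), of "set p"]
  have "in_edges P p = {}"
    using outer_end_not_adjacent[OF P p(1) closed] by (auto simp: in_edges_def)
  moreover have "card (out_edges p) + 2 * length p \<ge> 12"
    using split card_out_edges[OF pp p(2)] card_nbrs_in_path[OF pp mem(1)]
      card_nbrs_in_path[OF pp mem(2)] by linarith
  moreover have "length p = 6 \<Longrightarrow> card (out_edges p) \<ge> 1"
    using p(3) finite_out_edges by (simp add: Suc_le_eq card_gt_0_iff)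
  \<comment> \<open>With \<open>k = length p\<close>: for \<open>k \<le> 5\<close> the bound is
    \<open>3 * k + 2 * (12 - 2 * k) = 24 - k\<close>, for \<open>k = 6\<close> it is
    \<open>18 + 2\<close>, and for \<open>k \<ge> 7\<close> already
    \<open>3 * k \<ge> 21\<close>.\<close>
  ultimately show ?thesis by (cases "length p = 6"; cases "length p \<ge> 7") auto
qed

text \<open>Meant for the neighbours of an end within its own path: \<open>x\<close> is the path
  neighbour, and the chords supply the others.\<close>

lemma card_le_Suc_sum:
  fixes k :: nat
  assumes "S \<subseteq> insert x (f ` {j. j < k \<and> a j})"
  shows "card S \<le> Suc (\<Sum>j<k. of_bool (a j))"
proof -
  have fin: "finite {j. j < k \<and> a j}" by (rule finite_subset[of _ "{..<k}"]) auto
  have "card S \<le> card (insert x (f ` {j. j < k \<and> a j}))" using assms by (rule card_mono[rotated]) (simp add: fin)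
  also have "\<dots> \<le> Suc (card (f ` {j. j < k \<and> a j}))" by (simp add: card_insert_if)
  also have "\<dots> \<le> Suc (card {j. j < k \<and> a j})" by (simp add: card_image_le fin)
  also have "card {j. j < k \<and> a j} = (\<Sum>j<k. of_bool (a j))"
    by (simp add: of_bool_def sum.If_cases Int_def)
  finally show ?thesis .
qed

text \<open>Here \<open>n j\<close> counts the foreign ends adjacent to the \<open>j\<close>-th vertex, \<open>a j\<close> and \<open>b j\<close> say that
  it is joined to the first, respectively last, vertex of \<open>p\<close> by an edge that is not an edge of the path. The degree bounds
  \<open>n j + a j + b j\<close> by 3; rotations and minimality of \<open>P\<close> give the remaining hypotheses of
  \<open>sum_load_le\<close>.\<close>

lemma open_path_bound:
  assumes P: "min_partition V E P" and reg: "regular V E 5"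
    and p: "p \<in> P" "length p \<ge> 2"
    and not_closed: "x \<in> set p" "\<not> path_end V E (set p) x"
  shows "19 + 2 * card (in_edges P p) \<le> 3 * length p + 2 * card (out_edges p)"
proof -
  note Pd = min_partitionD[OF P]
  have pp: "is_path V E p" using Pd(2) p by simp
  have ne: "p \<noteq> []" and dist: "distinct p" and pV: "set p \<subseteq> V" using pp by (auto simp: is_path_iff)
  have step: "E (p ! i) (p ! Suc i)" if "Suc i < length p" for i
    using pp that by (simp add: is_path_def)
  have hd: "hd p = p ! 0" and last: "last p = p ! (length p - 1)"
    using ne by (simp_all add: hd_conv_nth last_conv_nth)
  \<comment> \<open>Such a crossing would yield a Hamiltonian cycle and make every vertex, even
    \<open>x\<close>, a path end.\<close>
  have no_cross: "\<not> (E (p ! 0) (p ! Suc i) \<and> E (last p) (p ! i))" if "Suc i < length p" for i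
    using path_end_crossing[OF pp that] not_closed by blast
  define m where "m = length p - 1"
  have m: "length p = Suc m" "m \<ge> 1" using p(2) by (auto simp: m_def)
  have "m \<noteq> 1"
  proof
    assume "m = 1"
    then have "E (p ! 0) (p ! Suc 0)" "E (last p) (p ! 0)"
      using step[of 0] E_sym m last by auto
    then show False using no_cross[of 0] m by auto
  qed
  then have m2: "m \<ge> 2" using m by simp
  have lastm: "last p = p ! m" using last m by simp
  define U where "U = \<Union>(ends ` P) - set p"
  define S where "S j = {u \<in> U. E u (p ! j)}" for j
  define n where "n j = card (S j)" for j
  define a where "a j \<longleftrightarrow> E (p ! 0) (p ! j) \<and> 2 \<le> j" for j
  define b where "b j \<longleftrightarrow> E (p ! m) (p ! j) \<and> Suc (Suc j) \<le> m" for j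
  have finS: "finite (S j)" for j
    by (rule finite_subset[OF _ finite_nbrs[of "p ! j"]]) (auto simp: S_def E_commute)
  have S_empty: "S j = {}" if "path_end V E (set p) (p ! j)" for j
    using outer_end_not_adjacent[OF P p(1) that] by (auto simp: S_def U_def)
  have S0: "S 0 = {}" and Sm: "S m = {}"
    using S_empty[of 0] S_empty[of m] path_end_hd[OF pp] path_end_last[OF pp] hd lastm by auto
  have not_a0: "\<not> a 0" and not_bm: "\<not> b m" by (auto simp: a_def b_def)
  \<comment> \<open>An edge joining the two ends of \<open>p\<close> would form a crossing with the
    last path edge, and likewise with the first one for \<open>not_b0\<close>.\<close>
  have not_am: "\<not> a m"
    using no_cross[of "m - 1"] step[of "m - 1"] E_sym m lastm by (auto simp: a_def)
  have not_b0: "\<not> b 0"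
    using no_cross[of 0] step[of 0] m lastm by (auto simp: b_def)
  have load: "2 * (\<Sum>j<Suc m. n j + of_bool (a j) + of_bool (b j)) \<le> 3 * m"
  proof (rule sum_load_le)
    fix j assume j: "j < m"
    then have j': "Suc j < length p" using m by simp
    \<comment> \<open>Rotating along the chord to \<open>p ! Suc j\<close> makes
      \<open>p ! j\<close> a path end, which foreign ends cannot see; a chord from
      \<open>p ! j\<close> to the last vertex would be a crossing.\<close>
    show "n j = 0 \<and> \<not> b j" if "a (Suc j)"
      using S_empty[OF path_end_rotate[OF pp j']] no_cross[OF j'] that lastm
      by (auto simp: a_def b_def n_def)
    show "n (Suc j) = 0 \<and> \<not> a (Suc j)" if "b j"
      using S_empty[OF path_end_rotate_last[OF pp j']] no_cross[OF j'] that lastm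
      by (auto simp: a_def b_def n_def)
    assume "n j > 0" "n (Suc j) > 0"
    then obtain u w where uw: "u \<in> S j" "w \<in> S (Suc j)"
      by (metis card_gt_0_iff ex_in_conv n_def)
    have "u' = w'" if "u' \<in> S j" "w' \<in> S (Suc j)" for u' w'
      using outer_end_unique[OF P p(1) j'] that by (auto simp: S_def U_def)
    then have "S j = {u}" "S (Suc j) = {u}" using uw by blast+
    then show "n j = 1 \<and> n (Suc j) = 1" by (simp add: n_def)
  next
    fix j assume j: "j \<le> m"
    show "n j + of_bool (a j) + of_bool (b j) \<le> 3"
    proof (cases "j = 0 \<or> j = m")
      case True
      then show ?thesis using S0 Sm not_a0 not_am not_b0 not_bm by (auto simp: n_def)
    next
      case False
      then obtain i where i: "j = Suc i" using not0_implies_Suc by blast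
      have lt: "Suc (Suc i) < length p" using False j i m by simp
      \<comment> \<open>Foreign ends, chord ends and the two path neighbours \<open>?I\<close> are
        distinct neighbours of \<open>p ! j\<close>; degree 5 leaves 3 for the load.\<close>
      let ?A = "(if a j then {p ! 0} else {})" and ?B = "(if b j then {p ! m} else {})"
      let ?I = "{p ! i, p ! Suc j}"
      have idx: "p ! k = p ! l \<longleftrightarrow> k = l" if "k \<le> m" "l \<le> m" for k l
        using nth_eq_iff_index_eq[OF dist] that m by simp
      have Sp: "S j \<inter> set p = {}" by (auto simp: S_def U_def)
      have mem: "p ! k \<in> set p" if "k \<le> m" for k using that m by simp
      have cA: "card ?A = of_bool (a j)" "card ?B = of_bool (b j)" by auto
      have cI: "card ?I = 2" using idx[of i "Suc j"] lt i m by simp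
      have "?A \<inter> ?B = {}" using idx[of 0 m] m by auto
      then have c1: "card (?A \<union> ?B) = of_bool (a j) + of_bool (b j)"
        by (subst card_Un_disjoint) (auto simp: cA)
      have "(?A \<union> ?B) \<inter> ?I = {}"
        using idx[of 0 i] idx[of 0 "Suc j"] idx[of m i] idx[of m "Suc j"] lt i m
        by (auto simp: a_def b_def)
      then have c2: "card (?A \<union> ?B \<union> ?I) = of_bool (a j) + of_bool (b j) + 2"
        by (subst card_Un_disjoint) (auto simp: c1 cI)
      have SABI: "S j \<inter> (?A \<union> ?B \<union> ?I) = {}"
        using Sp mem[of 0] mem[of m] mem[of i] mem[of "Suc j"] lt i m by (auto split: if_splits)
      then have c3: "card (S j \<union> (?A \<union> ?B \<union> ?I)) = n j + (of_bool (a j) + of_bool (b j) + 2)"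
        by (subst card_Un_disjoint[OF finS _ SABI]) (simp, simp only: c2 n_def)
      have "S j \<union> (?A \<union> ?B \<union> ?I) \<subseteq> {w. E (p ! j) w}"
        using step[of i] step[of j] lt i E_sym by (auto simp: S_def a_def b_def)
      then have "card (S j \<union> (?A \<union> ?B \<union> ?I)) \<le> card {w. E (p ! j) w}"
        by (rule card_mono[OF finite_nbrs])
      also have "\<dots> = 5"
        using card_nbrs_split[OF reg, of "p ! j" UNIV] pV mem[of j] j by auto
      finally show ?thesis using c3 by simp
    qed
  qed (use S0 Sm not_a0 not_am not_b0 not_bm in \<open>auto simp: n_def\<close>)
  have "card (in_edges P p) = card (SIGMA j:{..<Suc m}. S j)"
  proof (rule bij_betw_same_card[symmetric])
    show "bij_betw (\<lambda>(j, u). (u, p ! j)) (SIGMA j:{..<Suc m}. S j) (in_edges P p)"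
      unfolding bij_betw_def
    proof
      show "inj_on (\<lambda>(j, u). (u, p ! j)) (SIGMA j:{..<Suc m}. S j)"
        using nth_eq_iff_index_eq[OF dist] m by (auto simp: inj_on_def)
      show "(\<lambda>(j, u). (u, p ! j)) ` (SIGMA j:{..<Suc m}. S j) = in_edges P p"
        using m by (force simp: in_edges_def S_def U_def in_set_conv_nth image_iff)
    qed
  qed
  also have "\<dots> = (\<Sum>j<Suc m. n j)" by (subst card_SigmaI) (auto simp: finS n_def)
  finally have ins: "card (in_edges P p) = (\<Sum>j<Suc m. n j)" .
  have "card {w. E (hd p) w \<and> w \<in> set p} \<le> Suc (\<Sum>j<Suc m. of_bool (a j))"
  proof (rule card_le_Suc_sum)
    show "{w. E (hd p) w \<and> w \<in> set p} \<subseteq> insert (p ! 1) ((!) p ` {j. j < Suc m \<and> a j})"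
    proof
      fix w assume w: "w \<in> {w. E (hd p) w \<and> w \<in> set p}"
      then obtain j where j: "j < Suc m" "w = p ! j" using m by (auto simp: in_set_conv_nth)
      then have "j \<noteq> 0" using w hd E_irrefl by (cases j) auto
      then show "w \<in> insert (p ! 1) ((!) p ` {j. j < Suc m \<and> a j})"
        using w j hd by (cases "j = 1") (auto simp: a_def)
    qed
  qed
  moreover have "card {w. E (last p) w \<and> w \<in> set p} \<le> Suc (\<Sum>j<Suc m. of_bool (b j))"
  proof (rule card_le_Suc_sum)
    show "{w. E (last p) w \<and> w \<in> set p} \<subseteq> insert (p ! (m - 1)) ((!) p ` {j. j < Suc m \<and> b j})"
    proof
      fix w assume w: "w \<in> {w. E (last p) w \<and> w \<in> set p}"
      then obtain j where j: "j < Suc m" "w = p ! j" using m by (auto simp: in_set_conv_nth)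
      then have "j \<noteq> m" using w lastm E_irrefl by (cases "j = m") auto
      then show "w \<in> insert (p ! (m - 1)) ((!) p ` {j. j < Suc m \<and> b j})"
        using w j lastm by (cases "j = m - 1") (auto simp: b_def)
    qed
  qed
  moreover have "hd p \<in> V" "last p \<in> V" using pV ne by auto
  note split = card_nbrs_split[OF reg this(1), of "set p"] card_nbrs_split[OF reg this(2), of "set p"]
  \<comment> \<open>The two ends have total degree 10, and for each at most one neighbour inside
    \<open>p\<close> is not counted as a chord: \<open>10 - 2 = 8\<close>.\<close>
  ultimately have outs: "card (out_edges p) + (\<Sum>j<Suc m. of_bool (a j)) + (\<Sum>j<Suc m. of_bool (b j)) \<ge> 8"
    using card_out_edges[OF pp p(2)] by linarith
  have "2 * ((\<Sum>j<Suc m. n j) + (\<Sum>j<Suc m. of_bool (a j)) + (\<Sum>j<Suc m. of_bool (b j))) \<le> 3 * m"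
    using load by (simp only: sum.distrib)
  \<comment> \<open>With \<open>k = length p\<close> and \<open>c\<close> chords counted by
    \<open>a\<close> and \<open>b\<close>, adding twice \<open>outs\<close> gives
    \<open>3 * k + 2 * card (out_edges p) \<ge> 3 * k + 16 - 2 * c\<close>, while
    \<open>2 * c \<le> 3 * (k - 1) - 2 * card (in_edges P p)\<close>; the constants add up to
    exactly 19.\<close>
  then show ?thesis using outs ins m by presburger
qed

section \<open>Choice of the partition and conclusion\<close>

lemma ex_optimal: "\<exists>P. optimal P"
proof -
  have "path_partition V E ((\<lambda>v. [v]) ` V)"
    by (auto simp: path_partition_def is_path_def)
  from ex_has_least_nat[of "path_partition V E", OF this, of card]
  obtain P where "min_partition V E P" by (auto simp: min_partition_def)
  from ex_has_least_nat[of "min_partition V E", OF this, of "\<lambda>P. card (singletons P)"]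
  show ?thesis by (auto simp: optimal_def)
qed

text \<open>Among the optimal partitions take one with the fewest six-vertex components lacking an
  outgoing edge. If such a component is closed, re-traversing it from a vertex with a neighbour
  outside would lower that number.\<close>

lemma ex_optimal_leaving:
  assumes reg: "regular V E 5" and clique: "\<not> has_clique V E 6"
  shows "\<exists>P. optimal P \<and> (\<forall>p\<in>P. length p = 6
    \<longrightarrow> (\<forall>w\<in>set p. path_end V E (set p) w) \<longrightarrow> out_edges p \<noteq> {})"
proof -
  define bad where "bad P = {p \<in> P. length p = 6 \<and> out_edges p = {}}" for P
  obtain P0 where "optimal P0" using ex_optimal by blast
  from ex_has_least_nat[of optimal, OF this, of "\<lambda>P. card (bad P)"]
  obtain P where P: "optimal P" and least: "\<And>Q. optimal Q \<Longrightarrow> card (bad P) \<le> card (bad Q)"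
    by blast
  have mP: "min_partition V E P" using P by (simp add: optimal_def)
  note Pd = min_partitionD[OF mP]
  have "out_edges p \<noteq> {}"
    if p: "p \<in> P" "length p = 6" and closed: "\<forall>w\<in>set p. path_end V E (set p) w" for p
  proof
    assume out: "out_edges p = {}"
    have pp: "is_path V E p" using Pd(2) p by simp
    then have c6: "card (set p) = 6" and pV: "set p \<subseteq> V"
      using p(2) by (auto simp: is_path_iff distinct_card)
    then obtain u v where uv: "u \<in> set p" "v \<in> set p" "u \<noteq> v" "\<not> E u v"
      using clique unfolding has_clique_def by blast
    \<comment> \<open>\<open>u\<close> is adjacent neither to itself nor to \<open>v\<close>, so at
      most 4 of its 5 neighbours lie in the component.\<close>
    have "card {w. E u w \<and> w \<in> set p} \<le> card (set p - {u, v})"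
      by (rule card_mono) (use uv E_irrefl in auto)
    also have "\<dots> = 4" using uv c6 by (subst card_Diff_subset) auto
    finally have "card {w. E u w \<and> w \<notin> set p} \<noteq> 0"
      using card_nbrs_split[OF reg, of u "set p"] uv pV by auto
    then obtain w where w: "E u w" "w \<notin> set p" by (auto simp: card_eq_0_iff)
    obtain q where q: "is_path V E q" "set q = set p" "hd q = u"
      using closed uv(1) by (auto simp: path_end_def)
    have oq: "out_edges q \<noteq> {}" using w q by (auto simp: out_edges_def ends_def)
    have lq: "length q = 6" using q c6 by (metis distinct_card is_path_iff)
    have "q \<noteq> p" using oq out by auto
    have qP: "q \<notin> P" using Pd(3)[OF _ p(1), of q] \<open>q \<noteq> p\<close> q p(2) by auto
    let ?Q = "(P - {p}) \<union> {q}"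
    have mQ: "min_partition V E ?Q"
      by (rule min_partition_replace[OF mP]) (use p q in auto)
    moreover have "singletons ?Q \<subseteq> singletons P" using lq by (auto simp: singletons_def)
    then have "card (singletons ?Q) \<le> card (singletons P)"
      by (rule card_mono[rotated]) (simp add: singletons_def Pd(1))
    ultimately have "optimal ?Q" using P unfolding optimal_def by (meson le_trans)
    from least[OF this] have "card (bad P) \<le> card (bad ?Q)" .
    moreover have "bad ?Q \<subseteq> bad P - {p}" using oq by (auto simp: bad_def)
    then have "card (bad ?Q) \<le> card (bad P - {p})"
      by (rule card_mono[rotated]) (simp add: bad_def Pd(1))
    moreover have "card (bad P - {p}) < card (bad P)"
      by (rule card_Diff1_less) (use p out in \<open>simp_all add: bad_def Pd(1)\<close>)
    ultimately show False by linarith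
  qed
  then show ?thesis using P by blast
qed

end

theorem theorem2:
  fixes V :: "'a set" and E :: "'a \<Rightarrow> 'a \<Rightarrow> bool"
  assumes "simple_graph V E"
    and "regular V E 5"
    and "\<not> has_clique V E 6"
  shows "\<exists>P. path_partition V E P \<and> 19 * card P \<le> 3 * card V"
proof -
  interpret sgraph V E by unfold_locales (rule assms(1))
  obtain P where P: "optimal P"
    and leaving: "\<And>p. p \<in> P \<Longrightarrow> length p = 6 \<Longrightarrow> \<forall>w\<in>set p. path_end V E (set p) w
      \<Longrightarrow> out_edges p \<noteq> {}"
    using ex_optimal_leaving[OF assms(2,3)] by blast
  have mP: "min_partition V E P" using P by (simp add: optimal_def)
  note Pd = min_partitionD[OF mP]
  have "19 + 2 * card (in_edges P p) \<le> 3 * length p + 2 * card (out_edges p)" if p: "p \<in> P" for p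
  proof -
    have "p \<noteq> []" using Pd(2)[OF p] by (simp add: is_path_iff)
    moreover have "length p \<noteq> 1"
      using optimal_no_singletons[OF P assms(2)] p by (auto simp: length_Suc_conv)
    ultimately have len: "length p \<ge> 2" by (cases p rule: list.exhaust) (auto simp: Suc_le_eq)
    show ?thesis
      using closed_path_bound[OF mP assms(2) p len leaving[OF p]]
        open_path_bound[OF mP assms(2) p len] by blast
  qed
  then have "(\<Sum>p\<in>P. 19 + 2 * card (in_edges P p)) \<le> (\<Sum>p\<in>P. 3 * length p + 2 * card (out_edges p))"
    by (rule sum_mono)
  then have "19 * card P + 2 * (\<Sum>p\<in>P. card (in_edges P p))
      \<le> 3 * (\<Sum>p\<in>P. length p) + 2 * (\<Sum>p\<in>P. card (out_edges p))"
    by (simp add: sum.distrib flip: sum_distrib_left)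
  \<comment> \<open>Incoming and outgoing charges cancel in the total.\<close>
  then have "19 * card P \<le> 3 * card V"
    by (simp add: sum_out_edges_eq_sum_in_edges[OF mP] sum_length_partition[OF mP])
  then show ?thesis using min_partition_path_partition[OF mP] by blast
qed

end
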